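(* For every known i.d. input $(H,(\mathcal{D}_i)_{i=1}^n)$ with $H=(U,B,F)$ having downward-closed probing constraints, $\mathrm{OPT}(H,(\mathcal{D}_i)_{i=1}^n)\le\mathrm{LPOPT}(H,(\mathcal{D}_i)_{i=1}^n)$.
   Context: A stochastic graph is a finite bipartite graph $G=(U,V,E)$, $E=U\times V$, nonnegative weights $(w_e)$, probabilities $(p_e)\subseteq[0,1]$; each edge is independently active with probability $p_e$, its state revealed on probing. $S^{( * )}$: tuples of distinct elements of $S$ incl. the empty string $\lambda$; $\partial(v)$: edges at $v$; each $v$ has $\mathcal{C}_v\subseteq\partial(v)^{( * )}$, downward-closed (closed under substrings and permutations). Probe-commit model: when a probed edge is active, the algorithm must irrevocably decide whether to add it to its matching before further probes; only probed active edges can be added; output is a matching. An offline probing algorithm knows $G$ and adaptively (possibly randomly) probes edges in any order so that for each $v$ the probed edges of $\partial(v)$ in order form a string in $\mathcal{C}_v$; $\mathrm{OPT}(G)$ is the supremum over these of the expected output weight. Known i.d. input: a type graph $H=(U,B,F)$ (a stochastic graph with weights $w_{u,b}$, probabilities $p_{u,b}$, downward-closed $\mathcal{C}_b$), $n\ge1$ and distributions $\mathcal{D}_1,\dots,\mathcal{D}_n$ on $B$. The instantiated graph $G$ has online vertices $v_1,\dots,v_n$ with independent types $v_i\sim\mathcal{D}_i$, each a copy of its type (copied edges, weights, probabilities, constraint), with independent edge states. $\mathrm{OPT}(H,(\mathcal{D}_i)):=\mathbb{E}[\mathrm{OPT}(G)]$; $r_i(b)=\mathbb{P}[v_i=b]$.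 For $\bm e=(e_1,\dots,e_k)$: $g(\bm e)=\prod_j(1-p_{e_j})$, $g(\lambda)=1$, $\bm e_{<e_j}=(e_1,\dots,e_{j-1})$, $\mathrm{val}(\bm e)=\sum_jp_{e_j}w_{e_j}g(\bm e_{<e_j})$. $\mathrm{LPOPT}(H,(\mathcal{D}_i))$ is the optimum of LP-config-id: variables $x_i(\bm e\|b)\ge0$ ($i\in[n]$, $b\in B$, $\bm e\in\mathcal{C}_b$); maximize $\sum_{i,b,\bm e\in\mathcal{C}_b}\mathrm{val}(\bm e)x_i(\bm e\|b)$ subject to $\sum_{i\in[n],b\in B}\sum_{\bm e\in\mathcal{C}_b:(u,b)\in\bm e}p_{u,b}g(\bm e_{<(u,b)})x_i(\bm e\|b)\le1$ for all $u\in U$ and $\sum_{\bm e\in\mathcal{C}_b}x_i(\bm e\|b)=r_i(b)$ for all $b\in B$, $i\in[n]$. *)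

theory Defs
  imports "HOL-Probability.Probability" "HOL-Probability.Product_PMF" "HOL-Library.Sublist"
begin

section \<open>Stochastic graphs\<close>

record ('u, 'v) sgraph =
  offline :: "'u set"
  online :: "'v set"
  weight :: "'u \<times> 'v \<Rightarrow> real"
  prob_act :: "'u \<times> 'v \<Rightarrow> real"
  constr :: "'v \<Rightarrow> ('u \<times> 'v) list set"

definition edges :: "('u, 'v) sgraph \<Rightarrow> ('u \<times> 'v) set" where
  "edges G = offline G \<times> online G"

definition edges_at :: "('u, 'v) sgraph \<Rightarrow> 'v \<Rightarrow> ('u \<times> 'v) set" where
  "edges_at G v = offline G \<times> {v}"

definition strings :: "'a set \<Rightarrow> 'a list set" where
  "strings S = {xs. distinct xs \<and> set xs \<subseteq> S}"

definition downward_closed :: "'a list set \<Rightarrow> bool" where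
  "downward_closed C \<longleftrightarrow>
     (\<forall>xs\<in>C. \<forall>ys. sublist ys xs \<longrightarrow> ys \<in> C) \<and>
     (\<forall>xs\<in>C. \<forall>ys. mset ys = mset xs \<longrightarrow> ys \<in> C)"

text \<open>
  Constraint sets are required to be nonempty, hence contain the empty string; otherwise no
  probing algorithm exists and the configuration LP may be infeasible.
\<close>

definition stochastic_graph :: "('u, 'v) sgraph \<Rightarrow> bool" where
  "stochastic_graph G \<longleftrightarrow>
     finite (offline G) \<and> finite (online G) \<and>
     (\<forall>e\<in>edges G. 0 \<le> weight G e \<and> 0 \<le> prob_act G e \<and> prob_act G e \<le> 1) \<and>
     (\<forall>v\<in>online G. constr G v \<subseteq> strings (edges_at G v) \<and> constr G v \<noteq> {} \<and>
        downward_closed (constr G v))"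

definition edge_states :: "('u, 'v) sgraph \<Rightarrow> ('u \<times> 'v \<Rightarrow> bool) pmf" where
  "edge_states G = Pi_pmf (edges G) False (\<lambda>e. bernoulli_pmf (prob_act G e))"

definition is_matching :: "('u \<times> 'v) set \<Rightarrow> bool" where
  "is_matching M \<longleftrightarrow> inj_on fst M \<and> inj_on snd M"

section \<open>Offline probing in the probe-commit model\<close>

text \<open>
  A deterministic adaptive algorithm is a decision tree. \<open>Probe e a t t'\<close> probes \<open>e\<close>; if \<open>e\<close> is
  active, it is added to the output iff \<open>a\<close> holds and the algorithm goes on with \<open>t\<close>; if \<open>e\<close> is
  inactive, the algorithm goes on with \<open>t'\<close>.
\<close>

datatype 'e policy = Stop | Probe 'e bool "'e policy" "'e policy"

primrec probed :: "'e policy \<Rightarrow> ('e \<Rightarrow> bool) \<Rightarrow> 'e list" where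
  "probed Stop s = []"
| "probed (Probe e a t t') s = e # (if s e then probed t s else probed t' s)"

primrec accepted :: "'e policy \<Rightarrow> ('e \<Rightarrow> bool) \<Rightarrow> 'e set" where
  "accepted Stop s = {}"
| "accepted (Probe e a t t') s =
     (if s e then (if a then {e} else {}) \<union> accepted t s else accepted t' s)"

definition valid_policy :: "('u, 'v) sgraph \<Rightarrow> ('u \<times> 'v) policy \<Rightarrow> bool" where
  "valid_policy G t \<longleftrightarrow>
     (\<forall>s. set (probed t s) \<subseteq> edges G \<and>
          (\<forall>v\<in>online G. filter (\<lambda>e. e \<in> edges_at G v) (probed t s) \<in> constr G v) \<and>
          is_matching (accepted t s))"

text \<open>
  A randomized algorithm is a random decision tree drawn independently of the edge states.
  There are only finitely many valid trees for a stochastic graph, so a discrete distribution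
  is no restriction.
\<close>

definition probing_algorithms :: "('u, 'v) sgraph \<Rightarrow> ('u \<times> 'v) policy pmf set" where
  "probing_algorithms G = {A. \<forall>t\<in>set_pmf A. valid_policy G t}"

definition expected_weight :: "('u, 'v) sgraph \<Rightarrow> ('u \<times> 'v) policy pmf \<Rightarrow> real" where
  "expected_weight G A =
     measure_pmf.expectation (pair_pmf A (edge_states G)) (\<lambda>(t, s). \<Sum>e\<in>accepted t s. weight G e)"

definition OPT :: "('u, 'v) sgraph \<Rightarrow> real" where
  "OPT G = (SUP A\<in>probing_algorithms G. expected_weight G A)"

section \<open>Known i.d. inputs\<close>

definition known_id_input :: "('u, 'b) sgraph \<Rightarrow> nat \<Rightarrow> (nat \<Rightarrow> 'b pmf) \<Rightarrow> bool" where
  "known_id_input H n D \<longleftrightarrow>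
     stochastic_graph H \<and> n \<ge> 1 \<and> (\<forall>i\<in>{1..n}. set_pmf (D i) \<subseteq> online H)"

text \<open>The \<open>i\<close>-th arriving vertex is represented by its index \<open>i\<close>; its type is \<open>b i\<close>.\<close>

definition instantiate ::
    "('u, 'b) sgraph \<Rightarrow> nat \<Rightarrow> (nat \<Rightarrow> 'b) \<Rightarrow> ('u, nat) sgraph" where
  "instantiate H n b =
     \<lparr>offline = offline H,
      online = {1..n},
      weight = (\<lambda>(u, i). weight H (u, b i)),
      prob_act = (\<lambda>(u, i). prob_act H (u, b i)),
      constr = (\<lambda>i. map (\<lambda>(u, _). (u, i)) ` constr H (b i))\<rparr>"

definition OPT_id :: "('u, 'b) sgraph \<Rightarrow> nat \<Rightarrow> (nat \<Rightarrow> 'b pmf) \<Rightarrow> real" where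
  "OPT_id H n D =
     measure_pmf.expectation (Pi_pmf {1..n} undefined D) (\<lambda>b. OPT (instantiate H n b))"

section \<open>The configuration LP\<close>

definition prob_none :: "('u, 'b) sgraph \<Rightarrow> ('u \<times> 'b) list \<Rightarrow> real" where
  "prob_none H es = (\<Prod>e\<leftarrow>es. 1 - prob_act H e)"

definition before :: "'e \<Rightarrow> 'e list \<Rightarrow> 'e list" where
  "before e es = takeWhile (\<lambda>f. f \<noteq> e) es"

definition string_val :: "('u, 'b) sgraph \<Rightarrow> ('u \<times> 'b) list \<Rightarrow> real" where
  "string_val H es = (\<Sum>e\<leftarrow>es. prob_act H e * weight H e * prob_none H (before e es))"

definition LP_feasible ::
    "('u, 'b) sgraph \<Rightarrow> nat \<Rightarrow> (nat \<Rightarrow> 'b pmf) \<Rightarrow>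
     (nat \<Rightarrow> 'b \<Rightarrow> ('u \<times> 'b) list \<Rightarrow> real) \<Rightarrow> bool" where
  "LP_feasible H n D x \<longleftrightarrow>
     (\<forall>i\<in>{1..n}. \<forall>b\<in>online H. \<forall>es\<in>constr H b. 0 \<le> x i b es) \<and>
     (\<forall>u\<in>offline H.
        (\<Sum>i\<in>{1..n}. \<Sum>b\<in>online H. \<Sum>es\<in>{es\<in>constr H b. (u, b) \<in> set es}.
           prob_act H (u, b) * prob_none H (before (u, b) es) * x i b es) \<le> 1) \<and>
     (\<forall>i\<in>{1..n}. \<forall>b\<in>online H. (\<Sum>es\<in>constr H b. x i b es) = pmf (D i) b)"

definition LP_objective ::
    "('u, 'b) sgraph \<Rightarrow> nat \<Rightarrow> (nat \<Rightarrow> 'b \<Rightarrow> ('u \<times> 'b) list \<Rightarrow> real) \<Rightarrow> real" where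
  "LP_objective H n x =
     (\<Sum>i\<in>{1..n}. \<Sum>b\<in>online H. \<Sum>es\<in>constr H b. string_val H es * x i b es)"

definition LPOPT_id :: "('u, 'b) sgraph \<Rightarrow> nat \<Rightarrow> (nat \<Rightarrow> 'b pmf) \<Rightarrow> real" where
  "LPOPT_id H n D = (SUP x\<in>{x. LP_feasible H n D x}. LP_objective H n x)"

end

theory Submission
  imports Defs
begin

text \<open>
  Fix the types and a deterministic policy, and look at one online vertex \<open>v\<close>. The probabilities with
  which the edges at \<open>v\<close> are accepted form a convex combination of the vectors
  \<open>p\<^sub>e g(\<^bold>e\<^sub><\<^sub>e)\<close> belonging to strings \<open>\<^bold>e\<close> of the constraint set of \<open>v\<close>: at a probe of an edge
  at \<open>v\<close> that would be accepted, prepend this edge to a random string for the inactive branch (nothing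
  at \<open>v\<close> can be accepted in the active branch); at every other probe, flip a coin between the strings
  for the two branches. A rejected probe is thereby dropped, which downward closedness permits. The
  string distributions of almost optimal policies, averaged over the types, are feasible for the LP,
  since an offline vertex is matched at most once, and their objective value is the expected weight.
\<close>

section \<open>Acceptance probabilities of decision trees\<close>

text \<open>No path of the tree probes an edge twice, in a form suited to induction: below a probe
  of \<open>e\<close> the state of \<open>e\<close> is never consulted again, hence is independent
  of what happens there.\<close>

primrec fresh_policy :: "'e set \<Rightarrow> 'e policy \<Rightarrow> bool" where
  "fresh_policy A Stop \<longleftrightarrow> True"
| "fresh_policy A (Probe e a t t') \<longleftrightarrow>
     e \<in> A \<and> fresh_policy (A - {e}) t \<and> fresh_policy (A - {e}) t'"

lemma probed_fun_upd: "e \<notin> set (probed t s) \<Longrightarrow> probed t (s(e := x)) = probed t s"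
  by (induction t) (auto split: if_splits)

lemma accepted_fun_upd: "e \<notin> set (probed t s) \<Longrightarrow> accepted t (s(e := x)) = accepted t s"
  by (induction t) (auto split: if_splits)

lemma fresh_policy_probed: "fresh_policy A t \<Longrightarrow> set (probed t s) \<subseteq> A"
proof (induction t arbitrary: A)
  case (Probe e a t t')
  then have "e \<in> A" "set (probed t s) \<subseteq> A - {e}" "set (probed t' s) \<subseteq> A - {e}"
    by simp_all
  then show ?case by auto
qed simp

lemma accepted_subset_probed: "accepted t s \<subseteq> set (probed t s)"
  by (induction t) auto

text \<open>Every run of a subtree is the tail of a run of the whole tree: setting the state of the
  root edge \<open>e\<close> leads into the chosen subtree, and restoring it does not alter the rest
  of the run, where \<open>e\<close> is not probed.\<close>

lemma fresh_policyI:
  assumes "\<And>s. distinct (probed t s) \<and> set (probed t s) \<subseteq> A"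
  shows "fresh_policy A t"
  using assms
proof (induction t arbitrary: A)
  case (Probe e a t t')
  have "distinct (probed t s) \<and> set (probed t s) \<subseteq> A - {e}" for s
  proof -
    define s' where "s' = s(e := True)"
    have "s' e" "s = s'(e := s e)"
      by (auto simp: s'_def)
    have *: "distinct (probed t s') \<and> set (probed t s') \<subseteq> A - {e}"
      using Probe.prems[of s'] \<open>s' e\<close> by auto
    then have "probed t s = probed t s'"
      using probed_fun_upd[of e t s' "s e"] \<open>s = s'(e := s e)\<close> by auto
    with * show ?thesis by simp
  qed
  moreover have "distinct (probed t' s) \<and> set (probed t' s) \<subseteq> A - {e}" for s
  proof -
    define s' where "s' = s(e := False)"
    have "\<not> s' e" "s = s'(e := s e)"
      by (auto simp: s'_def)
    have *: "distinct (probed t' s') \<and> set (probed t' s') \<subseteq> A - {e}"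
      using Probe.prems[of s'] \<open>\<not> s' e\<close> by auto
    then have "probed t' s = probed t' s'"
      using probed_fun_upd[of e t' s' "s e"] \<open>s = s'(e := s e)\<close> by auto
    with * show ?thesis by simp
  qed
  moreover have "e \<in> A" using Probe.prems[of "\<lambda>_. True"] by auto
  ultimately show ?case using Probe.IH by simp
qed simp

text \<open>The inductions below assume a property of the runs under all states; this passes it on
  to both subtrees, since the state of \<open>e\<close> can be set freely without changing their
  runs.\<close>

lemma fresh_policy_Probe_runs:
  assumes "fresh_policy A (Probe e a t t')"
    and "\<And>s. Q (probed (Probe e a t t') s) (accepted (Probe e a t t') s)"
  shows "Q (e # probed t s) ((if a then {e} else {}) \<union> accepted t s)"
    and "Q (e # probed t' s) (accepted t' s)"
proof -
  have "e \<notin> set (probed t s)" "e \<notin> set (probed t' s)"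
    using assms(1) fresh_policy_probed[of "A - {e}"] by auto
  then show "Q (e # probed t s) ((if a then {e} else {}) \<union> accepted t s)"
    "Q (e # probed t' s) (accepted t' s)"
    using assms(2)[of "s(e := True)"] assms(2)[of "s(e := False)"]
    by (simp_all add: probed_fun_upd accepted_fun_upd)
qed

text \<open>The probability that \<open>f\<close> is accepted if the state is drawn anew at every
  probe. For fresh trees this agrees with states drawn in advance, by
  \<open>prob_accepted\<close>.\<close>

primrec accept_prob :: "('e \<Rightarrow> real) \<Rightarrow> 'e policy \<Rightarrow> 'e \<Rightarrow> real" where
  "accept_prob p Stop f = 0"
| "accept_prob p (Probe e a t t') f =
     p e * (if a \<and> e = f then 1 else accept_prob p t f) + (1 - p e) * accept_prob p t' f"

lemma expectation_bernoulli_bind_pmf: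
  fixes h :: "'a \<Rightarrow> real"
  assumes "0 \<le> p" "p \<le> 1" and "\<And>b. finite (set_pmf (q b))"
  shows "measure_pmf.expectation (bernoulli_pmf p \<bind> q) h =
    p * measure_pmf.expectation (q True) h + (1 - p) * measure_pmf.expectation (q False) h"
  using assms by (subst pmf_expectation_bind[of UNIV]) (auto simp: UNIV_bool)

lemma finite_set_Pi_pmf:
  assumes "finite A" "\<And>x. x \<in> A \<Longrightarrow> finite (set_pmf (p x))"
  shows "finite (set_pmf (Pi_pmf A d p))"
  using assms by (auto simp: set_Pi_pmf)

text \<open>The state of the root edge is split off from the product distribution. By freshness, the
  rest of the run depends only on the remaining coordinates, to which the induction hypothesis
  applies.\<close>

lemma prob_accepted:
  assumes "finite A" "fresh_policy A t" "\<And>e. e \<in> A \<Longrightarrow> 0 \<le> p e \<and> p e \<le> 1"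
  shows "measure_pmf.prob (Pi_pmf A False (\<lambda>e. bernoulli_pmf (p e))) {s. f \<in> accepted t s} =
    accept_prob p t f"
  using assms
proof (induction t arbitrary: A)
  case (Probe e a t t')
  define P where "P = Pi_pmf (A - {e}) False (\<lambda>e. bernoulli_pmf (p e))"
  have finP: "finite (set_pmf P)"
    using Probe.prems(1) unfolding P_def by (intro finite_set_Pi_pmf) auto
  have e: "e \<in> A" "fresh_policy (A - {e}) t" "fresh_policy (A - {e}) t'"
    using Probe.prems by auto
  have upd: "accepted t (s(e := x)) = accepted t s" "accepted t' (s(e := x)) = accepted t' s" for s x
    using e(2,3)[THEN fresh_policy_probed] by (auto intro!: accepted_fun_upd)
  have "Pi_pmf A False (\<lambda>e. bernoulli_pmf (p e)) =
      bernoulli_pmf (p e) \<bind> (\<lambda>b. map_pmf (\<lambda>s. s(e := b)) P)"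
    using Pi_pmf_insert'[of "A - {e}" e False "\<lambda>e. bernoulli_pmf (p e)"] e(1) Probe.prems(1)
    by (simp add: insert_absorb P_def map_pmf_def)
  then have "measure_pmf.prob (Pi_pmf A False (\<lambda>e. bernoulli_pmf (p e)))
        {s. f \<in> accepted (Probe e a t t') s} =
      measure_pmf.expectation (bernoulli_pmf (p e) \<bind> (\<lambda>b. map_pmf (\<lambda>s. s(e := b)) P))
        (indicator {s. f \<in> accepted (Probe e a t t') s})"
    by simp
  also have "\<dots> = p e * measure_pmf.prob P {s. f \<in> (if a then {e} else {}) \<union> accepted t s} +
      (1 - p e) * measure_pmf.prob P {s. f \<in> accepted t' s}"
    using Probe.prems(1,3) e(1)
    by (subst expectation_bernoulli_bind_pmf)
      (simp_all add: vimage_def upd finP)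
  also have "\<dots> = accept_prob p (Probe e a t t') f"
    using Probe.IH[of "A - {e}"] Probe.prems(1,3) e by (auto simp: P_def[symmetric])
  finally show ?case .
qed simp

text \<open>
  The random string of edges in \<open>E\<close>, all accepted if active, that reproduces the acceptance
  probabilities of the policy on \<open>E\<close>, provided that the policy accepts at most one edge of \<open>E\<close>.
\<close>

primrec commit_strings :: "('e \<Rightarrow> bool) \<Rightarrow> ('e \<Rightarrow> real) \<Rightarrow> 'e policy \<Rightarrow> 'e list pmf" where
  "commit_strings E p Stop = return_pmf []"
| "commit_strings E p (Probe e a t t') =
     (if E e \<and> a then map_pmf (Cons e) (commit_strings E p t')
      else bernoulli_pmf (p e) \<bind> (\<lambda>b. if b then commit_strings E p t else commit_strings E p t'))"

text \<open>The probability that \<open>f\<close> is the first active edge when the string is probed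
  in order, i.e. \<open>p f\<close> times the probability that everything before \<open>f\<close> is
  inactive. The recursion mirrors that of \<open>commit_strings\<close>.\<close>

primrec string_accept_prob :: "('e \<Rightarrow> real) \<Rightarrow> 'e list \<Rightarrow> 'e \<Rightarrow> real" where
  "string_accept_prob p [] f = 0"
| "string_accept_prob p (e # es) f = (if e = f then p e else (1 - p e) * string_accept_prob p es f)"

lemma finite_set_commit_strings: "finite (set_pmf (commit_strings E p t))"
  by (induction t) auto

text \<open>A string that can be drawn arises from the \<open>E\<close>-part of some run by deleting
  entries, and \<open>C\<close> is closed under such deletions.\<close>

lemma set_commit_strings:
  assumes "fresh_policy A t"
    and "\<And>s. filter E (probed t s) \<in> C"
    and "\<And>xs e ys. xs @ e # ys \<in> C \<Longrightarrow> xs @ ys \<in> C"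
  shows "set_pmf (commit_strings E p t) \<subseteq> C"
  using assms
proof (induction t arbitrary: A C)
  case (Probe e a t t')
  \<comment> \<open>After a probe in \<open>E\<close>, the later probes only have to continue
    \<open>[e]\<close> to a member of \<open>C\<close>, so the induction runs with this residual
    set. Deleting the leading \<open>e\<close> shows that it lies inside \<open>C\<close>.\<close>
  define C' where "C' = (if E e then {es. e # es \<in> C} else C)"
  note runs = fresh_policy_Probe_runs[OF Probe.prems(1), where Q="\<lambda>l _. filter E l \<in> C",
      OF Probe.prems(2)]
  have closed: "xs @ ys \<in> C'" if "xs @ f # ys \<in> C'" for xs f ys
    using Probe.prems(3)[of xs f ys] Probe.prems(3)[of "e # xs" f ys] that
    by (simp add: C'_def split: if_splits)
  have "filter E (probed t s) \<in> C'" "filter E (probed t' s) \<in> C'" for s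
    using runs[of s] by (auto simp: C'_def split: if_splits)
  then have "set_pmf (commit_strings E p t) \<subseteq> C'" "set_pmf (commit_strings E p t') \<subseteq> C'"
    using Probe.IH[of "A - {e}" C'] Probe.prems(1) closed by simp_all
  moreover have "C' \<subseteq> C"
    using Probe.prems(3)[of "[]" e] by (auto simp: C'_def)
  ultimately have sub: "set_pmf (commit_strings E p t) \<subseteq> C" "set_pmf (commit_strings E p t') \<subseteq> C"
    "E e \<Longrightarrow> Cons e ` set_pmf (commit_strings E p t') \<subseteq> C"
    by (auto simp: C'_def)
  show ?case
  proof (cases "E e \<and> a")
    case False
    then have "set_pmf (commit_strings E p (Probe e a t t')) \<subseteq>
        set_pmf (commit_strings E p t) \<union> set_pmf (commit_strings E p t')"
      by (auto split: if_splits)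
    with sub(1,2) show ?thesis by blast
  qed (use sub(3) in simp)
qed simp

text \<open>Used for branches in which the online vertex is already matched and for edges that have
  already been probed.\<close>

lemma accept_prob_eq_0:
  assumes "fresh_policy A t" "\<And>s. f \<notin> accepted t s"
  shows "accept_prob p t f = 0"
  using assms
proof (induction t arbitrary: A)
  case (Probe e a t t')
  note runs = fresh_policy_Probe_runs[OF Probe.prems(1), where Q="\<lambda>_ M. f \<notin> M",
      OF Probe.prems(2)]
  show ?case
    using Probe.prems Probe.IH[of "A - {e}"] runs by (auto split: if_splits)
qed simp

text \<open>Both sides obey the same recursion. The two rules of \<open>commit_strings\<close>
  correspond to probes that would match \<open>v\<close> and to all other probes, where both sides
  are the same mixture of the two branches.\<close>

lemma accept_prob_eq_expectation_strings:
  assumes "fresh_policy A t" "\<And>e. e \<in> A \<Longrightarrow> 0 \<le> p e \<and> p e \<le> 1"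
    and "\<And>s. inj_on snd (accepted t s)"
    and "snd f = v"
  shows "accept_prob p t f =
    measure_pmf.expectation (commit_strings (\<lambda>e. snd e = v) p t) (\<lambda>es. string_accept_prob p es f)"
  using assms
proof (induction t arbitrary: A)
  case (Probe e a t t')
  let ?q = "commit_strings (\<lambda>e. snd e = v) p"
  note runs = fresh_policy_Probe_runs[OF Probe.prems(1), where Q="\<lambda>_ M. inj_on snd M",
      OF Probe.prems(3)]
  have e: "e \<in> A" "fresh_policy (A - {e}) t" "fresh_policy (A - {e}) t'"
    using Probe.prems(1) by auto
  have "inj_on snd (accepted t s)" for s
    using runs(1)[of s] by (rule inj_on_subset) auto
  then have IH: "accept_prob p t f =
      measure_pmf.expectation (?q t) (\<lambda>es. string_accept_prob p es f)"
    using e Probe.prems by (intro Probe.IH(1)[of "A - {e}"]) auto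
  have IH': "accept_prob p t' f =
      measure_pmf.expectation (?q t') (\<lambda>es. string_accept_prob p es f)"
    using e Probe.prems runs(2) by (intro Probe.IH(2)[of "A - {e}"]) auto
  show ?case
  proof (cases "snd e = v \<and> a")
    case True
    have notin: "e \<notin> accepted t s" "e \<notin> accepted t' s" for s
      using fresh_policy_probed[OF e(2), of s] fresh_policy_probed[OF e(3), of s]
        accepted_subset_probed[of t s] accepted_subset_probed[of t' s] by auto
    \<comment> \<open>In the active branch \<open>v\<close> is already matched by \<open>e\<close>,
      so accepting another edge at \<open>v\<close> would violate injectivity of
      \<open>snd\<close>.\<close>
    have "f \<notin> accepted t s" for s
      using runs(1)[of s] True Probe.prems(4) notin(1)[of s] by (auto simp: inj_on_def)
    then have "accept_prob p t f = 0"
      by (rule accept_prob_eq_0[OF e(2)])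
    \<comment> \<open>This settles the case \<open>f = e\<close>: an edge found inactive is not
      accepted later, so only the term \<open>p e\<close> remains.\<close>
    moreover have "accept_prob p t' e = 0"
      by (rule accept_prob_eq_0[OF e(3) notin(2)])
    ultimately show ?thesis
      using True IH' by auto
  next
    case False
    then have q: "commit_strings (\<lambda>e. snd e = v) p (Probe e a t t') =
        bernoulli_pmf (p e) \<bind> (\<lambda>b. if b then ?q t else ?q t')"
      by (simp only: commit_strings.simps if_False simp_thms)
    have "\<not> (a \<and> e = f)"
      using False Probe.prems(4) by auto
    then show ?thesis
      unfolding q using e(1) Probe.prems(2)[of e] IH IH'
      by (subst expectation_bernoulli_bind_pmf) (auto simp: finite_set_commit_strings)
  qed
qed simp

section \<open>LP coefficients of a string in terms of acceptance probabilities\<close>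

lemma string_accept_prob_eq:
  "string_accept_prob (prob_act G) es f =
    (if f \<in> set es then prob_act G f * prob_none G (before f es) else 0)"
  by (induction es) (auto simp: before_def prob_none_def)

text \<open>The value of a string is linear in its vector of acceptance probabilities, so convex
  combinations of these vectors carry over to the objective.\<close>

lemma string_val_eq:
  assumes "distinct es" "set es \<subseteq> F" "finite F"
  shows "string_val G es = (\<Sum>f\<in>F. weight G f * string_accept_prob (prob_act G) es f)"
proof -
  have "string_val G es = (\<Sum>f\<in>set es. prob_act G f * weight G f * prob_none G (before f es))"
    using assms(1) by (simp add: string_val_def sum_list_distinct_conv_sum_set)
  also have "\<dots> = (\<Sum>f\<in>F. weight G f * string_accept_prob (prob_act G) es f)"
    using assms by (intro sum.mono_neutral_cong_left) (auto simp: string_accept_prob_eq)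
  finally show ?thesis .
qed


text \<open>\<open>sublist\<close> refers to contiguous blocks, so an inner entry is first permuted
  to the front and then cut off.\<close>

lemma downward_closed_remove:
  assumes "downward_closed C" "xs @ e # ys \<in> C"
  shows "xs @ ys \<in> C"
proof -
  have "e # xs @ ys \<in> C"
    using assms unfolding downward_closed_def
    by (metis mset.simps(2) mset_append union_mset_add_mset_right)
  moreover have "sublist (xs @ ys) (e # xs @ ys)"
    by (metis append_Cons append_Nil sublist_append_leftI)
  ultimately show ?thesis
    using assms(1) unfolding downward_closed_def by blast
qed

section \<open>Stochastic graphs and instantiation\<close>

lemma stochastic_graphD:
  assumes "stochastic_graph G"
  shows "finite (offline G)" "finite (online G)" "finite (edges G)"
    and "e \<in> edges G \<Longrightarrow> 0 \<le> weight G e"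
    and "e \<in> edges G \<Longrightarrow> 0 \<le> prob_act G e \<and> prob_act G e \<le> 1"
    and "v \<in> online G \<Longrightarrow> constr G v \<subseteq> strings (edges_at G v)"
    and "v \<in> online G \<Longrightarrow> constr G v \<noteq> {}"
    and "v \<in> online G \<Longrightarrow> downward_closed (constr G v)"
  using assms by (auto simp: stochastic_graph_def edges_def)

lemma Nil_in_constr:
  assumes "stochastic_graph G" "v \<in> online G"
  shows "[] \<in> constr G v"
proof -
  obtain es where "es \<in> constr G v"
    using stochastic_graphD(7)[OF assms] by blast
  moreover have "sublist [] es" by simp
  ultimately show ?thesis
    using stochastic_graphD(8)[OF assms] unfolding downward_closed_def by blast
qed

lemma finite_constr:
  assumes "stochastic_graph G" "v \<in> online G"
  shows "finite (constr G v)"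
proof (rule finite_subset)
  show "constr G v \<subseteq> {xs. set xs \<subseteq> edges_at G v \<and> distinct xs}"
    using stochastic_graphD(6)[OF assms] by (auto simp: strings_def)
  show "finite {xs. set xs \<subseteq> edges_at G v \<and> distinct xs}"
    using stochastic_graphD(1)[OF assms(1)] by (intro finite_subset_distinct) (simp add: edges_at_def)
qed

text \<open>Since the old online end is discarded, the same map copies the edges of a type to a
  vertex and takes the copies back.\<close>

definition relabel :: "'c \<Rightarrow> 'u \<times> 'b \<Rightarrow> 'u \<times> 'c" where
  "relabel c e = (fst e, c)"

lemma map_relabel_relabel:
  "set es \<subseteq> U \<times> {b} \<Longrightarrow> map (relabel b) (map (relabel c) es) = es"
  by (induction es) (auto simp: relabel_def)

lemma instantiate_simps [simp]:
  "offline (instantiate H n b) = offline H"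
  "online (instantiate H n b) = {1..n}"
  "weight (instantiate H n b) (u, i) = weight H (u, b i)"
  "prob_act (instantiate H n b) (u, i) = prob_act H (u, b i)"
  "constr (instantiate H n b) i = map (relabel i) ` constr H (b i)"
proof -
  have "(\<lambda>(u, _). (u, i)) = (relabel i :: 'a \<times> 'b \<Rightarrow> _)"
    by (auto simp: relabel_def)
  then show "constr (instantiate H n b) i = map (relabel i) ` constr H (b i)"
    by (simp add: instantiate_def)
qed (simp_all add: instantiate_def)

text \<open>A substring or permutation of a copied string has all its edges at \<open>c\<close>, so
  it is the copy of its own pull-back by \<open>relabel b\<close>, which lies in
  \<open>C\<close>.\<close>

lemma downward_closed_relabel:
  assumes C: "downward_closed C" and sub: "C \<subseteq> strings (U \<times> {b})"
  shows "downward_closed (map (relabel c) ` C)"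
proof -
  have *: "ys = map (relabel c) (map (relabel b) ys)" if "set ys \<subseteq> set (map (relabel c) es)" for ys es
    using that by (intro map_relabel_relabel[symmetric, of _ UNIV]) (auto simp: relabel_def)
  have inverse: "map (relabel b) (map (relabel c) es) = es" if "es \<in> C" for es
    using that sub by (intro map_relabel_relabel[of _ U]) (auto simp: strings_def)
  show ?thesis
    unfolding downward_closed_def
  proof (intro conjI ballI allI impI)
    fix xs ys assume "xs \<in> map (relabel c) ` C" and ys: "sublist ys xs"
    then obtain es where es: "es \<in> C" "xs = map (relabel c) es" by auto
    have "sublist (map (relabel b) ys) es"
      using map_mono_sublist[OF ys, of "relabel b"] inverse[OF es(1)] es(2) by simp
    then have "map (relabel b) ys \<in> C"
      using C es(1) unfolding downward_closed_def by blast
    then show "ys \<in> map (relabel c) ` C"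
      using *[of ys es] set_mono_sublist[OF ys] es(2) by blast
  next
    fix xs ys assume "xs \<in> map (relabel c) ` C" and ys: "mset ys = mset xs"
    then obtain es where es: "es \<in> C" "xs = map (relabel c) es" by auto
    have "mset (map (relabel b) ys) = mset es"
      using ys inverse[OF es(1)] es(2) by (metis mset_map)
    then have "map (relabel b) ys \<in> C"
      using C es(1) unfolding downward_closed_def by blast
    then show "ys \<in> map (relabel c) ` C"
      using *[of ys es] mset_eq_setD[OF ys] es(2) by blast
  qed
qed

lemma stochastic_graph_instantiate:
  assumes H: "stochastic_graph H" and b: "\<And>i. i \<in> {1..n} \<Longrightarrow> b i \<in> online H"
  shows "stochastic_graph (instantiate H n b)"
proof -
  have "map (relabel i) ` constr H (b i) \<subseteq> strings (offline H \<times> {i}) \<and>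
      map (relabel i) ` constr H (b i) \<noteq> {} \<and>
      downward_closed (map (relabel i) ` constr H (b i))" if "i \<in> {1..n}" for i
  proof -
    have sub: "constr H (b i) \<subseteq> strings (offline H \<times> {b i})"
      using stochastic_graphD(6)[OF H b[OF that]] by (simp add: edges_at_def)
    have "map (relabel i) es \<in> strings (offline H \<times> {i})" if "es \<in> constr H (b i)" for es
    proof -
      have "distinct es" "set es \<subseteq> offline H \<times> {b i}"
        using sub that by (auto simp: strings_def)
      moreover have "inj_on (relabel i) (offline H \<times> {b i})"
        by (auto simp: relabel_def inj_on_def)
      moreover have "relabel i ` (offline H \<times> {b i}) \<subseteq> offline H \<times> {i}"
        by (auto simp: relabel_def)
      ultimately show ?thesis
        unfolding strings_def distinct_map mem_Collect_eq set_map
        by (meson image_mono inj_on_subset subset_trans)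
    qed
    then have "map (relabel i) ` constr H (b i) \<subseteq> strings (offline H \<times> {i})"
      by (rule image_subsetI)
    then show ?thesis
      using downward_closed_relabel[OF stochastic_graphD(8)[OF H b[OF that]] sub]
        stochastic_graphD(7)[OF H b[OF that]] by simp
  qed
  moreover have "0 \<le> weight H (u, b i) \<and> 0 \<le> prob_act H (u, b i) \<and> prob_act H (u, b i) \<le> 1"
    if "u \<in> offline H" "i \<in> {1..n}" for u i
    using stochastic_graphD(4,5)[OF H, of "(u, b i)"] b[OF that(2)] that(1) by (simp add: edges_def)
  ultimately show ?thesis
    using stochastic_graphD(1)[OF H]
    unfolding stochastic_graph_def edges_def edges_at_def by simp
qed

section \<open>Valid policies as fresh trees\<close>

lemma distinct_if_distinct_filters:
  assumes "\<And>x. x \<in> set xs \<Longrightarrow> \<exists>P. P x \<and> distinct (filter P xs)"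
  shows "distinct xs"
  using assms
proof (induction xs)
  case (Cons a xs)
  have "\<exists>P. P x \<and> distinct (filter P xs)" if "x \<in> set xs" for x
    using Cons.prems[of x] that by (auto split: if_splits)
  moreover have "a \<notin> set xs"
    using Cons.prems[of a] by auto
  ultimately show ?case using Cons.IH by simp
qed simp

text \<open>Each probed edge lies at some online vertex, and the probes at that vertex form a
  constraint string, which is distinct. Hence no edge is repeated in a run.\<close>

lemma valid_policy_fresh:
  assumes G: "stochastic_graph G" and t: "valid_policy G t"
  shows "fresh_policy (edges G) t"
proof (rule fresh_policyI)
  fix s
  have sub: "set (probed t s) \<subseteq> edges G"
    using t by (auto simp: valid_policy_def)
  moreover have "distinct (probed t s)"
  proof (rule distinct_if_distinct_filters)
    fix e assume "e \<in> set (probed t s)"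
    then have v: "snd e \<in> online G" and e: "e \<in> edges_at G (snd e)"
      using sub by (auto simp: edges_def edges_at_def)
    have "filter (\<lambda>e'. e' \<in> edges_at G (snd e)) (probed t s) \<in> constr G (snd e)"
      using t v unfolding valid_policy_def by blast
    then have "distinct (filter (\<lambda>e'. e' \<in> edges_at G (snd e)) (probed t s))"
      using stochastic_graphD(6)[OF G v] by (auto simp: strings_def)
    with e show "\<exists>P. P e \<and> distinct (filter P (probed t s))"
      by (intro exI[of _ "\<lambda>e'. e' \<in> edges_at G (snd e)"] conjI)
  qed
  ultimately show "distinct (probed t s) \<and> set (probed t s) \<subseteq> edges G" by simp
qed

lemma valid_policy_accepted:
  assumes "valid_policy G t"
  shows "accepted t s \<subseteq> edges G" "is_matching (accepted t s)"
  using assms order_trans[OF accepted_subset_probed[of t s]] by (simp_all add: valid_policy_def)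

lemma valid_policy_Stop:
  assumes "stochastic_graph G"
  shows "valid_policy G Stop"
  using Nil_in_constr[OF assms] by (simp add: valid_policy_def is_matching_def)

section \<open>Near-optimal deterministic policies\<close>

text \<open>For a valid policy this is the expected weight of the output, by linearity of
  expectation.\<close>

definition policy_weight :: "('u, 'v) sgraph \<Rightarrow> ('u \<times> 'v) policy \<Rightarrow> real" where
  "policy_weight G t = (\<Sum>f\<in>edges G. weight G f * accept_prob (prob_act G) t f)"

lemma integrable_edge_states:
  fixes h :: "_ \<Rightarrow> real"
  assumes "stochastic_graph G"
  shows "integrable (measure_pmf (edge_states G)) h"
  using stochastic_graphD(3)[OF assms] unfolding edge_states_def
  by (intro integrable_measure_pmf_finite finite_set_Pi_pmf) auto

text \<open>Linearity of expectation. It is applied with all edges and their weights, and with the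
  edges at one offline vertex and \<open>c = 1\<close>.\<close>

lemma expectation_sum_accepted:
  fixes c :: "_ \<Rightarrow> real"
  assumes G: "stochastic_graph G" and t: "valid_policy G t" and F: "finite F"
  shows "measure_pmf.expectation (edge_states G) (\<lambda>s. \<Sum>f\<in>accepted t s \<inter> F. c f) =
    (\<Sum>f\<in>F. c f * accept_prob (prob_act G) t f)"
proof -
  have "(\<Sum>f\<in>accepted t s \<inter> F. c f) = (\<Sum>f\<in>F. c f * indicator {s. f \<in> accepted t s} s)" for s
    using F by (intro sum.mono_neutral_cong_left) (auto simp: indicator_def)
  then have "measure_pmf.expectation (edge_states G) (\<lambda>s. \<Sum>f\<in>accepted t s \<inter> F. c f) =
      (\<Sum>f\<in>F. c f * measure_pmf.prob (edge_states G) {s. f \<in> accepted t s})"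
    by (simp add: Bochner_Integration.integral_sum integrable_edge_states[OF G])
  also have "\<dots> = (\<Sum>f\<in>F. c f * accept_prob (prob_act G) t f)"
    using stochastic_graphD(3,5)[OF G] valid_policy_fresh[OF G t]
    by (simp add: edge_states_def prob_accepted)
  finally show ?thesis .
qed

text \<open>Randomization does not help: a random policy achieves an average of deterministic
  values. Weights are nonnegative, so the average is computed with iterated extended nonnegative
  integrals.\<close>

lemma expected_weight_le:
  assumes G: "stochastic_graph G" and A: "A \<in> probing_algorithms G"
    and le: "\<And>t. valid_policy G t \<Longrightarrow> policy_weight G t \<le> c"
  shows "expected_weight G A \<le> c"
proof -
  let ?w = "\<lambda>t s. \<Sum>e\<in>accepted t s. weight G e"
  have valid: "valid_policy G t" if "t \<in> set_pmf A" for t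
    using A that by (simp add: probing_algorithms_def)
  have nonneg: "0 \<le> ?w t s" if "t \<in> set_pmf A" for t s
    using valid_policy_accepted(1)[OF valid[OF that]] stochastic_graphD(4)[OF G]
    by (intro sum_nonneg) auto
  have inner: "(\<integral>\<^sup>+s. ennreal (?w t s) \<partial>edge_states G) \<le> ennreal c" if "t \<in> set_pmf A" for t
  proof -
    have "(\<integral>\<^sup>+s. ennreal (?w t s) \<partial>edge_states G) =
        ennreal (measure_pmf.expectation (edge_states G) (?w t))"
      using nonneg[OF that] by (intro nn_integral_eq_integral integrable_edge_states[OF G]) auto
    also have "measure_pmf.expectation (edge_states G) (?w t) = policy_weight G t"
      using expectation_sum_accepted[OF G valid[OF that] stochastic_graphD(3)[OF G], of "weight G"]
        valid_policy_accepted(1)[OF valid[OF that]]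
      by (simp add: policy_weight_def Int_absorb2)
    finally show ?thesis
      using le[OF valid[OF that]] by (simp add: ennreal_leI)
  qed
  have "expected_weight G A =
      enn2real (\<integral>\<^sup>+z. ennreal (case z of (t, s) \<Rightarrow> ?w t s) \<partial>pair_pmf A (edge_states G))"
    unfolding expected_weight_def
    using nonneg by (intro integral_eq_nn_integral) (auto simp: AE_measure_pmf_iff)
  also have "(\<integral>\<^sup>+z. ennreal (case z of (t, s) \<Rightarrow> ?w t s) \<partial>pair_pmf A (edge_states G)) =
      (\<integral>\<^sup>+t. \<integral>\<^sup>+s. ennreal (?w t s) \<partial>edge_states G \<partial>A)"
    by (simp add: nn_integral_pair_pmf')
  finally have "expected_weight G A =
      enn2real (\<integral>\<^sup>+t. \<integral>\<^sup>+s. ennreal (?w t s) \<partial>edge_states G \<partial>A)" .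
  moreover have "(\<integral>\<^sup>+t. \<integral>\<^sup>+s. ennreal (?w t s) \<partial>edge_states G \<partial>A) \<le> (\<integral>\<^sup>+t. ennreal c \<partial>A)"
    using inner by (intro nn_integral_mono_AE) (auto simp: AE_measure_pmf_iff)
  ultimately have "expected_weight G A \<le> enn2real (ennreal c)"
    by (simp add: enn2real_mono)
  \<comment> \<open>The policy \<open>Stop\<close> has weight 0; nonnegativity of \<open>c\<close>
    makes \<open>enn2real (ennreal c)\<close> equal to \<open>c\<close>.\<close>
  moreover have "0 \<le> c"
    using le[OF valid_policy_Stop[OF G]] by (simp add: policy_weight_def)
  ultimately show ?thesis by simp
qed

text \<open>If all deterministic policies stayed below \<open>OPT G - \<epsilon>\<close>, so would
  all randomized ones, and hence their supremum \<open>OPT G\<close> itself.\<close>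

lemma exists_near_optimal_policy:
  assumes G: "stochastic_graph G" and "0 < \<epsilon>"
  shows "\<exists>t. valid_policy G t \<and> OPT G \<le> policy_weight G t + \<epsilon>"
proof (rule ccontr)
  assume contra: "\<not> ?thesis"
  define c where "c = OPT G - \<epsilon>"
  have le: "policy_weight G t \<le> c" if "valid_policy G t" for t
    using that contra by (force simp: c_def)
  have "return_pmf Stop \<in> probing_algorithms G"
    using valid_policy_Stop[OF G] by (simp add: probing_algorithms_def)
  then have "OPT G \<le> c"
    unfolding OPT_def using expected_weight_le[OF G _ le] by (intro cSUP_least) auto
  with \<open>0 < \<epsilon>\<close> show False by (simp add: c_def)
qed

text \<open>In every state the accepted edges form a matching and thus contain at most one edge at
  \<open>u\<close>; taking expectations gives the bound behind the offline constraints of the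
  LP.\<close>

lemma sum_accept_prob_le_1:
  assumes G: "stochastic_graph G" and t: "valid_policy G t"
  shows "(\<Sum>v\<in>online G. accept_prob (prob_act G) t (u, v)) \<le> 1"
proof -
  have "(\<Sum>f\<in>accepted t s \<inter> {u} \<times> online G. 1) \<le> (1::real)" for s
  proof -
    have "inj_on fst (accepted t s)"
      using valid_policy_accepted(2)[OF t] by (simp add: is_matching_def)
    then have "card (accepted t s \<inter> {u} \<times> online G) = card (fst ` (accepted t s \<inter> {u} \<times> online G))"
      by (intro card_image[symmetric]) (auto intro: inj_on_subset)
    also have "\<dots> \<le> card {u}"
      by (intro card_mono) auto
    finally show ?thesis by simp
  qed
  then have "measure_pmf.expectation (edge_states G) (\<lambda>s. \<Sum>f\<in>accepted t s \<inter> {u} \<times> online G. 1)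
      \<le> (1::real)"
    by (intro measure_pmf.integral_le_const integrable_edge_states[OF G]) auto
  then have "(\<Sum>f\<in>{u} \<times> online G. accept_prob (prob_act G) t f) \<le> 1"
    using expectation_sum_accepted[OF G t, of "{u} \<times> online G" "\<lambda>_. 1"] stochastic_graphD(2)[OF G]
    by simp
  then show ?thesis
    by (simp add: sum.cartesian_product')
qed

section \<open>From policies to LP solutions\<close>

lemma string_accept_prob_relabel:
  assumes "set es \<subseteq> U \<times> {b i}"
  shows "string_accept_prob (prob_act (instantiate H n b)) (map (relabel i) es) (u, i) =
    string_accept_prob (prob_act H) es (u, b i)"
  using assms by (induction es) (auto simp: relabel_def)

text \<open>\<open>y i\<close> is the distribution of the random string of vertex \<open>i\<close>,
  pulled back from the copies at \<open>i\<close> to strings of its type \<open>b i\<close>. In this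
  form the distributions for different type vectors can be averaged.\<close>

lemma accept_prob_instantiate_eq_sum_strings:
  assumes H: "stochastic_graph H" and b: "\<And>i. i \<in> {1..n} \<Longrightarrow> b i \<in> online H"
    and t: "valid_policy (instantiate H n b) t"
  shows "\<exists>y. \<forall>i\<in>{1..n}. (\<forall>es. 0 \<le> y i es) \<and> (\<Sum>es\<in>constr H (b i). y i es) = (1::real) \<and>
    (\<forall>u\<in>offline H. accept_prob (prob_act (instantiate H n b)) t (u, i) =
      (\<Sum>es\<in>constr H (b i). string_accept_prob (prob_act H) es (u, b i) * y i es))"
proof (intro exI ballI conjI allI)
  define G where "G = instantiate H n b"
  define q where "q i = commit_strings (\<lambda>e. snd e = i) (prob_act G) t" for i
  let ?y = "\<lambda>i es. pmf (q i) (map (relabel i) es)"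
  have G: "stochastic_graph G"
    unfolding G_def using H b by (rule stochastic_graph_instantiate)
  have t': "valid_policy G t" using t by (simp add: G_def)
  fix i assume i: "i \<in> {1..n}"
  then have iG: "i \<in> online G" by (simp add: G_def)
  have sub: "set es \<subseteq> offline H \<times> {b i}" if "es \<in> constr H (b i)" for es
    using stochastic_graphD(6)[OF H b[OF i]] that by (auto simp: strings_def edges_at_def)
  have inj: "inj_on (map (relabel i)) (constr H (b i))"
    using map_relabel_relabel[OF sub] by (rule inj_on_inverseI)
  have q: "set_pmf (q i) \<subseteq> constr G i"
    unfolding q_def
  proof (rule set_commit_strings[OF valid_policy_fresh[OF G t']])
    fix s
    have "filter (\<lambda>e. snd e = i) (probed t s) = filter (\<lambda>e. e \<in> edges_at G i) (probed t s)"
      using t' by (intro filter_cong) (auto simp: valid_policy_def edges_def edges_at_def)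
    then show "filter (\<lambda>e. snd e = i) (probed t s) \<in> constr G i"
      using t' iG by (simp add: valid_policy_def)
  qed (rule downward_closed_remove[OF stochastic_graphD(8)[OF G iG]])
  have reindex: "(\<Sum>es\<in>constr G i. h es * pmf (q i) es) =
      (\<Sum>es\<in>constr H (b i). h (map (relabel i) es) * ?y i es)" for h
    by (simp add: G_def sum.reindex[OF inj])
  show "0 \<le> ?y i es" for es by simp
  have "(\<Sum>es\<in>constr G i. pmf (q i) es) = 1"
    using q finite_constr[OF G iG] by (intro sum_pmf_eq_1)
  then show "(\<Sum>es\<in>constr H (b i). ?y i es) = 1"
    using reindex[of "\<lambda>_. 1"] by simp
  fix u
  have "accept_prob (prob_act G) t (u, i) =
      measure_pmf.expectation (q i) (\<lambda>es. string_accept_prob (prob_act G) es (u, i))"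
    unfolding q_def
    using valid_policy_fresh[OF G t'] stochastic_graphD(5)[OF G] valid_policy_accepted(2)[OF t']
    by (intro accept_prob_eq_expectation_strings) (auto simp: is_matching_def)
  also have "\<dots> = (\<Sum>es\<in>constr G i. string_accept_prob (prob_act G) es (u, i) * pmf (q i) es)"
    using q finite_constr[OF G iG] by (intro integral_measure_pmf_real) auto
  also have "\<dots> = (\<Sum>es\<in>constr H (b i). string_accept_prob (prob_act H) es (u, b i) * ?y i es)"
    unfolding reindex unfolding G_def
    using sub by (intro sum.cong refl arg_cong2[where f="(*)"] string_accept_prob_relabel) blast
  finally show "accept_prob (prob_act (instantiate H n b)) t (u, i) =
      (\<Sum>es\<in>constr H (b i). string_accept_prob (prob_act H) es (u, b i) * ?y i es)"
    by (simp add: G_def)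
qed

text \<open>Each variable lies between 0 and 1, because the variables of \<open>i\<close> and
  \<open>b\<close> sum to a probability. Boundedness is what makes the real supremum
  \<open>LPOPT_id\<close> an upper bound for the objective of feasible points.\<close>

lemma LP_objective_bdd_above:
  assumes H: "stochastic_graph H"
  shows "bdd_above (LP_objective H n ` {x. LP_feasible H n D x})"
proof (rule bdd_aboveI2)
  fix x assume "x \<in> {x. LP_feasible H n D x}"
  then have x: "LP_feasible H n D x" by simp
  show "LP_objective H n x \<le> (\<Sum>i\<in>{1..n}. \<Sum>b\<in>online H. \<Sum>es\<in>constr H b. \<bar>string_val H es\<bar>)"
    unfolding LP_objective_def
  proof (intro sum_mono)
    fix i b es assume i: "i \<in> {1..n}" "b \<in> online H" "es \<in> constr H b"
    have "0 \<le> x i b es"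
      using x i by (simp add: LP_feasible_def)
    have "x i b es \<le> (\<Sum>es\<in>constr H b. x i b es)"
      using x i finite_constr[OF H i(2)] by (intro member_le_sum) (auto simp: LP_feasible_def)
    also have "\<dots> = pmf (D i) b"
      using x i by (simp add: LP_feasible_def)
    also have "\<dots> \<le> 1" by (rule pmf_le_1)
    finally have "\<bar>string_val H es\<bar> * x i b es \<le> \<bar>string_val H es\<bar> * 1"
      by (intro mult_left_mono) auto
    moreover have "string_val H es * x i b es \<le> \<bar>string_val H es\<bar> * x i b es"
      using \<open>0 \<le> x i b es\<close> by (intro mult_right_mono) auto
    ultimately show "string_val H es * x i b es \<le> \<bar>string_val H es\<bar>" by simp
  qed
qed

theorem theorem18:
  fixes H :: "('u, 'b) sgraph" and n :: nat and D :: "nat \<Rightarrow> 'b pmf"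
  assumes "known_id_input H n D"
  shows "OPT_id H n D \<le> LPOPT_id H n D"
proof (rule field_le_epsilon)
  \<comment> \<open>The slack pays for choosing, for each type vector, a policy that is only nearly
    optimal.\<close>
  fix \<epsilon> :: real assume "0 < \<epsilon>"
  have H: "stochastic_graph H" and D: "\<And>i. i \<in> {1..n} \<Longrightarrow> set_pmf (D i) \<subseteq> online H"
    using assms by (auto simp: known_id_input_def)
  define W where "W = Pi_pmf {1..n} undefined D"
  \<comment> \<open>Only finitely many type vectors occur, so expectations over the types become
    finite sums.\<close>
  define S where "S = set_pmf W"
  have S: "finite S"
    unfolding S_def W_def
    using D stochastic_graphD(2)[OF H] by (intro finite_set_Pi_pmf) (auto intro: finite_subset)
  have W_sum: "measure_pmf.expectation W h = (\<Sum>\<beta>\<in>S. pmf W \<beta> * h \<beta>)" for h :: "_ \<Rightarrow> real"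
    using S by (subst integral_measure_pmf[of S]) (auto simp: S_def)
  have W_1: "(\<Sum>\<beta>\<in>S. pmf W \<beta>) = 1"
    using S by (intro sum_pmf_eq_1) (auto simp: S_def)
  have types: "\<beta> i \<in> online H" if "\<beta> \<in> S" "i \<in> {1..n}" for \<beta> i
    using that D[OF that(2)] unfolding S_def W_def by (force simp: set_Pi_pmf PiE_dflt_def)
  define G where "G = instantiate H n"
  have G: "stochastic_graph (G \<beta>)" if "\<beta> \<in> S" for \<beta>
    unfolding G_def using H types[OF that] by (rule stochastic_graph_instantiate)
  have "\<forall>\<beta>\<in>S. \<exists>t. valid_policy (G \<beta>) t \<and> OPT (G \<beta>) \<le> policy_weight (G \<beta>) t + \<epsilon>"
    using exists_near_optimal_policy[OF G \<open>0 < \<epsilon>\<close>] by blast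
  then obtain T where T: "\<And>\<beta>. \<beta> \<in> S \<Longrightarrow> valid_policy (G \<beta>) (T \<beta>)"
      "\<And>\<beta>. \<beta> \<in> S \<Longrightarrow> OPT (G \<beta>) \<le> policy_weight (G \<beta>) (T \<beta>) + \<epsilon>"
    by metis
  let ?acc = "\<lambda>\<beta>. accept_prob (prob_act (G \<beta>)) (T \<beta>)"
  let ?sacc = "string_accept_prob (prob_act H)"
  define Y where "Y \<beta> y \<longleftrightarrow> (\<forall>i\<in>{1..n}. (\<forall>es. 0 \<le> y i es) \<and>
      (\<Sum>es\<in>constr H (\<beta> i). y i es) = (1::real) \<and>
      (\<forall>u\<in>offline H. ?acc \<beta> (u, i) = (\<Sum>es\<in>constr H (\<beta> i). ?sacc es (u, \<beta> i) * y i es)))" for \<beta> y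
  have "\<exists>y. Y \<beta> y" if "\<beta> \<in> S" for \<beta>
    unfolding Y_def G_def
    using H types[OF that] T(1)[OF that, unfolded G_def] by (rule accept_prob_instantiate_eq_sum_strings)
  then obtain y where Y: "\<And>\<beta>. \<beta> \<in> S \<Longrightarrow> Y \<beta> (y \<beta>)"
    by metis
  have y: "0 \<le> y \<beta> i es" "(\<Sum>es\<in>constr H (\<beta> i). y \<beta> i es) = 1"
    "u \<in> offline H \<Longrightarrow> ?acc \<beta> (u, i) = (\<Sum>es\<in>constr H (\<beta> i). ?sacc es (u, \<beta> i) * y \<beta> i es)"
    if "\<beta> \<in> S" "i \<in> {1..n}" for \<beta> i es u
    using bspec[OF Y[OF that(1), unfolded Y_def] that(2)] by blast+
  \<comment> \<open>\<open>x i b es\<close> is the joint probability that vertex \<open>i\<close>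
    has type \<open>b\<close> and draws the string \<open>es\<close>, averaged over the types of all
    vertices.\<close>
  define x where "x i b es = (\<Sum>\<beta>\<in>S. pmf W \<beta> * (if \<beta> i = b then y \<beta> i es else 0))" for i b es
  \<comment> \<open>For a fixed type vector \<open>\<beta>\<close> only \<open>b = \<beta> i\<close>
    contributes. The identity is used with \<open>h\<close> the acceptance probabilities at an
    offline vertex and with \<open>h\<close> the string values.\<close>
  have x_sum: "(\<Sum>b\<in>online H. \<Sum>es\<in>constr H b. h b es * x i b es) =
      (\<Sum>\<beta>\<in>S. pmf W \<beta> * (\<Sum>es\<in>constr H (\<beta> i). h (\<beta> i) es * y \<beta> i es))"
    if i: "i \<in> {1..n}" for i and h :: "'b \<Rightarrow> ('u \<times> 'b) list \<Rightarrow> real"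
  proof -
    have "(\<Sum>b\<in>online H. \<Sum>es\<in>constr H b. h b es * x i b es) =
        (\<Sum>b\<in>online H. \<Sum>es\<in>constr H b. \<Sum>\<beta>\<in>S.
          if b = \<beta> i then pmf W \<beta> * (h b es * y \<beta> i es) else 0)"
      unfolding x_def by (auto simp: sum_distrib_left mult_ac intro!: sum.cong)
    also have "\<dots> = (\<Sum>b\<in>online H. \<Sum>\<beta>\<in>S. \<Sum>es\<in>constr H b.
          if b = \<beta> i then pmf W \<beta> * (h b es * y \<beta> i es) else 0)"
      by (intro sum.cong refl sum.swap)
    also have "\<dots> = (\<Sum>\<beta>\<in>S. \<Sum>b\<in>online H. \<Sum>es\<in>constr H b.
          if b = \<beta> i then pmf W \<beta> * (h b es * y \<beta> i es) else 0)"
      by (rule sum.swap)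
    also have "\<dots> = (\<Sum>\<beta>\<in>S. \<Sum>b\<in>online H.
          if b = \<beta> i then pmf W \<beta> * (\<Sum>es\<in>constr H b. h b es * y \<beta> i es) else 0)"
      by (intro sum.cong refl) (simp add: sum_distrib_left)
    also have "\<dots> = (\<Sum>\<beta>\<in>S. pmf W \<beta> * (\<Sum>es\<in>constr H (\<beta> i). h (\<beta> i) es * y \<beta> i es))"
      using stochastic_graphD(2)[OF H] types[OF _ i] by (intro sum.cong refl) simp
    finally show ?thesis .
  qed
  have "LP_feasible H n D x"
    unfolding LP_feasible_def
  proof (intro conjI ballI)
    fix i b es assume "i \<in> {1..n}"
    then show "0 \<le> x i b es"
      unfolding x_def using y(1) by (intro sum_nonneg) auto
  next
    fix u assume u: "u \<in> offline H"
    \<comment> \<open>Strings that avoid \<open>(u, b)\<close> have acceptance probability 0 there,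
      so the restricted sum extends to all strings.\<close>
    have "(\<Sum>i\<in>{1..n}. \<Sum>b\<in>online H. \<Sum>es\<in>{es\<in>constr H b. (u, b) \<in> set es}.
           prob_act H (u, b) * prob_none H (before (u, b) es) * x i b es) =
        (\<Sum>i\<in>{1..n}. \<Sum>b\<in>online H. \<Sum>es\<in>constr H b. ?sacc es (u, b) * x i b es)"
      using finite_constr[OF H]
      by (intro sum.cong refl sum.mono_neutral_cong_left) (auto simp: string_accept_prob_eq)
    also have "\<dots> = (\<Sum>i\<in>{1..n}. \<Sum>\<beta>\<in>S. pmf W \<beta> * ?acc \<beta> (u, i))"
      using y(3)[OF _ _ u] by (intro sum.cong refl) (simp add: x_sum)
    also have "\<dots> = (\<Sum>\<beta>\<in>S. pmf W \<beta> * (\<Sum>i\<in>{1..n}. ?acc \<beta> (u, i)))"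
      by (subst sum.swap) (simp add: sum_distrib_left)
    also have "\<dots> \<le> (\<Sum>\<beta>\<in>S. pmf W \<beta> * 1)"
      using sum_accept_prob_le_1[OF G T(1)] by (intro sum_mono mult_left_mono) (auto simp: G_def)
    finally show "(\<Sum>i\<in>{1..n}. \<Sum>b\<in>online H. \<Sum>es\<in>{es\<in>constr H b. (u, b) \<in> set es}.
           prob_act H (u, b) * prob_none H (before (u, b) es) * x i b es) \<le> 1"
      using W_1 by simp
  next
    fix i b assume i: "i \<in> {1..n}"
    have "(\<Sum>es\<in>constr H b. x i b es) =
        (\<Sum>\<beta>\<in>S. \<Sum>es\<in>constr H b. pmf W \<beta> * (if \<beta> i = b then y \<beta> i es else 0))"
      unfolding x_def by (rule sum.swap)
    \<comment> \<open>The string probabilities of vertex \<open>i\<close> sum to 1 under each type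
      vector, which leaves the probability that vertex \<open>i\<close> has type
      \<open>b\<close>.\<close>
    also have "\<dots> = (\<Sum>\<beta>\<in>S. pmf W \<beta> * indicator {\<beta>. \<beta> i = b} \<beta>)"
    proof (intro sum.cong refl)
      fix \<beta> assume "\<beta> \<in> S"
      then show "(\<Sum>es\<in>constr H b. pmf W \<beta> * (if \<beta> i = b then y \<beta> i es else 0)) =
          pmf W \<beta> * indicator {\<beta>. \<beta> i = b} \<beta>"
        using y(2)[OF _ i, of \<beta>] by (cases "\<beta> i = b") (simp_all flip: sum_distrib_left)
    qed
    also have "\<dots> = measure_pmf.prob W {\<beta>. \<beta> i = b}"
      using W_sum[of "indicator {\<beta>. \<beta> i = b}"] by simp
    also have "\<dots> = pmf (map_pmf (\<lambda>\<beta>. \<beta> i) W) b"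
      by (simp add: pmf_map vimage_def)
    also have "map_pmf (\<lambda>\<beta>. \<beta> i) W = D i"
      unfolding W_def using i by (subst Pi_pmf_component) auto
    finally show "(\<Sum>es\<in>constr H b. x i b es) = pmf (D i) b" .
  qed
  moreover have "LP_objective H n x = (\<Sum>\<beta>\<in>S. pmf W \<beta> * policy_weight (G \<beta>) (T \<beta>))"
  proof -
    have pw: "policy_weight (G \<beta>) (T \<beta>) =
        (\<Sum>i\<in>{1..n}. \<Sum>es\<in>constr H (\<beta> i). string_val H es * y \<beta> i es)" if \<beta>: "\<beta> \<in> S" for \<beta>
    proof -
      have "policy_weight (G \<beta>) (T \<beta>) =
          (\<Sum>u\<in>offline H. \<Sum>i\<in>{1..n}. weight H (u, \<beta> i) * ?acc \<beta> (u, i))"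
        unfolding policy_weight_def edges_def
        by (simp add: G_def sum.cartesian_product')
      also have "\<dots> = (\<Sum>i\<in>{1..n}. \<Sum>u\<in>offline H. weight H (u, \<beta> i) * ?acc \<beta> (u, i))"
        by (rule sum.swap)
      also have "\<dots> = (\<Sum>i\<in>{1..n}. \<Sum>es\<in>constr H (\<beta> i). string_val H es * y \<beta> i es)"
      proof (intro sum.cong refl)
        fix i assume i: "i \<in> {1..n}"
        \<comment> \<open>All edges of a string of type \<open>\<beta> i\<close> lie at
          \<open>\<beta> i\<close>, so the sum over edges becomes a sum over offline vertices and
          can be exchanged with the sum over strings.\<close>
        have val: "string_val H es = (\<Sum>u\<in>offline H. weight H (u, \<beta> i) * ?sacc es (u, \<beta> i))"
          if "es \<in> constr H (\<beta> i)" for es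
        proof -
          have "es \<in> strings (edges_at H (\<beta> i))"
            using stochastic_graphD(6)[OF H types[OF \<beta> i]] that by blast
          then have "string_val H es = (\<Sum>f\<in>offline H \<times> {\<beta> i}. weight H f * ?sacc es f)"
            using stochastic_graphD(1)[OF H]
            by (intro string_val_eq) (auto simp: strings_def edges_at_def)
          then show ?thesis by (simp add: sum.cartesian_product')
        qed
        have "(\<Sum>u\<in>offline H. weight H (u, \<beta> i) * ?acc \<beta> (u, i)) =
            (\<Sum>u\<in>offline H. \<Sum>es\<in>constr H (\<beta> i).
              weight H (u, \<beta> i) * ?sacc es (u, \<beta> i) * y \<beta> i es)"
          using y(3)[OF \<beta> i] by (intro sum.cong refl) (simp add: sum_distrib_left mult.assoc)
        also have "\<dots> = (\<Sum>es\<in>constr H (\<beta> i). \<Sum>u\<in>offline H.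
              weight H (u, \<beta> i) * ?sacc es (u, \<beta> i) * y \<beta> i es)"
          by (rule sum.swap)
        also have "\<dots> = (\<Sum>es\<in>constr H (\<beta> i). string_val H es * y \<beta> i es)"
          by (intro sum.cong refl) (simp add: val sum_distrib_right)
        finally show "(\<Sum>u\<in>offline H. weight H (u, \<beta> i) * ?acc \<beta> (u, i)) =
            (\<Sum>es\<in>constr H (\<beta> i). string_val H es * y \<beta> i es)" .
      qed
      finally show ?thesis .
    qed
    have "LP_objective H n x =
        (\<Sum>i\<in>{1..n}. \<Sum>\<beta>\<in>S. pmf W \<beta> * (\<Sum>es\<in>constr H (\<beta> i). string_val H es * y \<beta> i es))"
      unfolding LP_objective_def by (intro sum.cong refl x_sum)
    also have "\<dots> = (\<Sum>\<beta>\<in>S. pmf W \<beta> * policy_weight (G \<beta>) (T \<beta>))"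
      by (subst sum.swap) (simp add: pw sum_distrib_left)
    finally show ?thesis .
  qed
  ultimately have LP: "(\<Sum>\<beta>\<in>S. pmf W \<beta> * policy_weight (G \<beta>) (T \<beta>)) \<le> LPOPT_id H n D"
    unfolding LPOPT_id_def using LP_objective_bdd_above[OF H]
    by (metis (mono_tags, lifting) cSUP_upper mem_Collect_eq)
  have "OPT_id H n D = (\<Sum>\<beta>\<in>S. pmf W \<beta> * OPT (G \<beta>))"
    unfolding OPT_id_def W_def[symmetric] G_def by (rule W_sum)
  also have "\<dots> \<le> (\<Sum>\<beta>\<in>S. pmf W \<beta> * (policy_weight (G \<beta>) (T \<beta>) + \<epsilon>))"
    using T(2) by (intro sum_mono mult_left_mono) auto
  also have "\<dots> = (\<Sum>\<beta>\<in>S. pmf W \<beta> * policy_weight (G \<beta>) (T \<beta>)) + \<epsilon>"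
    using W_1 by (simp add: distrib_left sum.distrib sum_distrib_right[symmetric])
  finally show "OPT_id H n D \<le> LPOPT_id H n D + \<epsilon>"
    using LP by simp
qed

end
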